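(* Let $n,s_1,s_2$ be integers such that $0\le s_1<s_2<n$, and let $a,b$ be non-zero complex numbers. Then $$\operatorname{perm}\left(aP_n^{s_1}+bP_n^{s_2}\right)=\left(a^{\,n\backslash(s_2-s_1)}+b^{\,n\backslash(s_2-s_1)}\right)^{(n,\,s_2-s_1)}.$$
   Context: $\operatorname{perm}$ denotes the permanent of a square matrix. Matrix indices run over $\{0,1,\dots,n-1\}$. $P_n$ is the $n\times n$ permutation matrix with $(P_n)_{i,j}=1$ if $j\equiv i+1\pmod n$ and $0$ otherwise; $P_n^0=I_n$. $(n,s)$ denotes the greatest common divisor of $n$ and $s$, and $n\backslash s:=n/(n,s)$. *)

theory Defs
  imports Complex_Main "HOL-Number_Theory.Cong" "Jordan_Normal_Form.Matrix"
begin

text \<open>As for \<open>det\<close> in \<open>Jordan_Normal_Form.Determinant\<close>, the value on non-square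
  matrices is the junk value 0.\<close>

definition permanent :: "'a :: comm_semiring_1 mat \<Rightarrow> 'a" where
  "permanent A = (if dim_row A = dim_col A
     then (\<Sum>p \<in> {p. p permutes {0..<dim_row A}}. \<Prod>i = 0..<dim_row A. A $$ (i, p i))
     else 0)"

definition cyclic_perm_mat :: "nat \<Rightarrow> 'a :: zero_neq_one mat" where
  "cyclic_perm_mat n = mat n n (\<lambda>(i, j). if [j = i + 1] (mod n) then 1 else 0)"

text \<open>The paper's \<open>n\<close>-backslash-\<open>s\<close>; the division is exact.\<close>

definition gcd_quot :: "nat \<Rightarrow> nat \<Rightarrow> nat" where
  "gcd_quot n s = n div gcd n s"

end

theory Submission
  imports Defs "HOL-Combinatorics.Permutations"
begin

text \<open>A permutation \<open>p\<close> contributes to the permanent only if each \<open>p i\<close> is \<open>i + s\<^sub>1\<close> or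
  \<open>i + s\<^sub>2\<close> modulo \<open>n\<close>.  Injectivity forces the set of those \<open>i\<close> with \<open>p i = i + s\<^sub>2\<close> to be
  closed under adding \<open>d = s\<^sub>2 - s\<^sub>1\<close>, so it is a union of residue classes modulo \<open>gcd n d\<close>;
  conversely every such union arises.  Each class has \<open>n div gcd n d\<close> elements, and
  summing over all sets of classes expands the product on the right.\<close>

lemma cyclic_perm_mat_pow:
  "cyclic_perm_mat n ^\<^sub>m s
    = (mat n n (\<lambda>(i, j). if [j = i + s] (mod n) then 1 else 0) :: 'a :: semiring_1 mat)"
proof (induction s)
  case 0
  show ?case
    by (rule eq_matI) (auto simp: cyclic_perm_mat_def cong_def)
next
  case (Suc s)
  show ?case
  proof (rule eq_matI)
    fix i j
    assume "i < dim_row (mat n n (\<lambda>(i, j). if [j = i + Suc s] (mod n) then 1 else 0) :: 'a mat)"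
      and "j < dim_col (mat n n (\<lambda>(i, j). if [j = i + Suc s] (mod n) then 1 else 0) :: 'a mat)"
    then have ij: "i < n" "j < n" by auto
    \<comment> \<open>Row \<open>i\<close> of the \<open>s\<close>-th power has its only 1 in column
      \<open>k\<close>, so the sum for the matrix product collapses to the term
      \<open>l = k\<close>.\<close>
    define k where "k = (i + s) mod n"
    have k: "k < n" using ij by (simp add: k_def)
    have eq: "[l = i + s] (mod n) \<longleftrightarrow> l = k" if "l < n" for l
      using that by (simp add: cong_def k_def)
    have "(cyclic_perm_mat n ^\<^sub>m Suc s :: 'a mat) $$ (i, j)
        = (\<Sum>l = 0..<n. (if [l = i + s] (mod n) then 1 else 0)
            * (if [j = l + 1] (mod n) then 1 else 0))"
      unfolding pow_mat.simps Suc.IH using ij by (simp add: cyclic_perm_mat_def scalar_prod_def)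
    also have "\<dots> = (\<Sum>l = 0..<n. if l = k then (if [j = k + 1] (mod n) then 1 else 0) else 0)"
      by (intro sum.cong) (auto simp: eq)
    also have "\<dots> = (if [j = k + 1] (mod n) then 1 else 0)"
      using k by simp
    also have "[j = k + 1] (mod n) \<longleftrightarrow> [j = i + Suc s] (mod n)"
      by (simp add: k_def cong_def mod_simps)
    finally show "(cyclic_perm_mat n ^\<^sub>m Suc s :: 'a mat) $$ (i, j)
        = mat n n (\<lambda>(i, j). if [j = i + Suc s] (mod n) then 1 else 0) $$ (i, j)"
      using ij by simp
  qed (simp_all add: cyclic_perm_mat_def)
qed

text \<open>A union of residue classes modulo \<open>g\<close> is encoded by the set
  \<open>R\<close> of its residues. Fixing every \<open>i \<ge> n\<close> is what
  \<open>permutes\<close> demands outside \<open>{0..<n}\<close>.\<close>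

definition class_shift :: "nat \<Rightarrow> nat \<Rightarrow> nat \<Rightarrow> nat \<Rightarrow> nat set \<Rightarrow> nat \<Rightarrow> nat" where
  "class_shift n s t g R i
    = (if i < n then (i + (if i mod g \<in> R then t else s)) mod n else i)"

text \<open>Both shifts agree modulo \<open>g\<close>, so the image of \<open>i\<close> determines
  \<open>i mod g\<close> and thereby which shift was applied; that shift can then be cancelled
  modulo \<open>n\<close>.\<close>

lemma class_shift_permutes:
  assumes "g dvd n" and "[s = t] (mod g)"
  shows "class_shift n s t g R permutes {0..<n}"
proof (rule bij_imp_permutes)
  have "inj_on (class_shift n s t g R) {0..<n}"
  proof (rule inj_onI)
    fix i j
    assume ij: "i \<in> {0..<n}" "j \<in> {0..<n}" and eq: "class_shift n s t g R i = class_shift n s t g R j"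
    define c where "c = (\<lambda>i. if i mod g \<in> R then t else s)"
    have c: "[c i = s] (mod g)" for i
      using assms(2) by (auto simp: c_def cong_sym)
    have n: "[i + c i = j + c j] (mod n)"
      using eq ij by (simp add: class_shift_def c_def cong_def)
    have "[i + c i = j + c j] (mod g)"
      using n assms(1) by (rule cong_dvd_modulus_nat)
    then have "[i + s = j + s] (mod g)"
      by (meson c cong_add cong_refl cong_sym cong_trans)
    then have "i mod g = j mod g"
      by (simp add: cong_add_rcancel_nat flip: cong_def)
    then have "c i = c j" by (simp add: c_def)
    with n have "[i = j] (mod n)" by (simp add: cong_add_rcancel_nat)
    with ij show "i = j" by (simp add: cong_def)
  qed
  moreover have "class_shift n s t g R ` {0..<n} \<subseteq> {0..<n}"
    by (auto simp: class_shift_def)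
  ultimately show "bij_betw (class_shift n s t g R) {0..<n} {0..<n}"
    by (simp add: bij_betw_def endo_inj_surj)
qed (simp add: class_shift_def)

lemma shift_mod_neq:
  fixes s t n i :: nat
  assumes "s < t" "t < n"
  shows "(i + s) mod n \<noteq> (i + t) mod n"
proof
  assume "(i + s) mod n = (i + t) mod n"
  then have "[s = t] (mod n)" by (simp add: cong_add_lcancel_nat flip: cong_def)
  with assms show False by (simp add: cong_def)
qed

text \<open>Each \<open>r < g\<close> is its own residue and lies below \<open>n\<close>, so the
  value at \<open>r\<close> reveals whether \<open>r\<close> is in \<open>R\<close>, as the two
  shifts never agree modulo \<open>n\<close>.\<close>

lemma class_shift_inj_on:
  assumes "s < t" "t < n" and "g \<le> n"
  shows "inj_on (class_shift n s t g) (Pow {0..<g})"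
proof (rule inj_onI)
  fix R S
  assume RS: "R \<in> Pow {0..<g}" "S \<in> Pow {0..<g}"
    and eq: "class_shift n s t g R = class_shift n s t g S"
  have "r \<in> R \<longleftrightarrow> r \<in> S" if "r < g" for r
    using fun_cong[OF eq, of r] that assms shift_mod_neq[OF assms(1,2), of r]
    by (auto simp: class_shift_def split: if_splits)
  with RS show "R = S" by auto
qed

lemma permutes_shift_or_imp_class_shift:
  assumes st: "s < t" "t < n" and p: "p permutes {0..<n}"
    and p_or: "\<And>i. i < n \<Longrightarrow> p i = (i + s) mod n \<or> p i = (i + t) mod n"
  defines "g \<equiv> gcd n (t - s)"
  shows "\<exists>R \<in> Pow {0..<g}. p = class_shift n s t g R"
proof -
  define d where "d = t - s"
  define T where "T = {i. i < n \<and> p i = (i + t) mod n}"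
  have n: "n > 0" and t: "t = s + d" and g: "g = gcd n d" "g > 0"
    using st by (auto simp: d_def g_def)
  have step: "(i + d) mod n \<in> T" if "i \<in> T" for i
  proof (rule ccontr)
    define j where "j = (i + d) mod n"
    assume "(i + d) mod n \<notin> T"
    then have j: "j < n" "j \<notin> T" using n by (auto simp: j_def)
    \<comment> \<open>Outside \<open>T\<close> the shift is by \<open>s\<close>, and
      \<open>j + s\<close> is congruent to \<open>i + t\<close> modulo \<open>n\<close>; hence
      \<open>j\<close> and \<open>i\<close> would have the same image.\<close>
    have "p j = (j + s) mod n" using j p_or[of j] by (auto simp: T_def)
    also have "\<dots> = p i"
      using that by (simp add: T_def j_def t mod_simps ac_simps)
    finally have "j = i" using permutes_inj[OF p] by (simp add: inj_eq)
    with j that show False by simp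
  qed
  have steps: "(i + k * d) mod n \<in> T" if "i \<in> T" for i k
  proof (induction k)
    case 0
    then show ?case using that by (simp add: T_def)
  next
    case (Suc k)
    from step[OF this] show ?case by (simp add: mod_simps ac_simps)
  qed
  have closed: "j \<in> T" if "i \<in> T" and "j < n" and "[i = j] (mod g)" for i j
  proof -
    have i: "i < n" using \<open>i \<in> T\<close> by (simp add: T_def)
    \<comment> \<open>By Bezout, \<open>x\<close> steps of length \<open>d\<close> amount to one
      step of length \<open>g\<close> modulo \<open>n\<close>, so closure under \<open>d\<close>
      gives closure under \<open>g\<close>.\<close>
    obtain x where x: "[d * x = g] (mod n)"
      using cong_solve_nat[of d n] st by (auto simp: g gcd.commute d_def)
    \<comment> \<open>Adding \<open>n\<close>, a multiple of \<open>g\<close>, keeps the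
      natural-number difference \<open>j + n - i\<close> from being truncated when
      \<open>j < i\<close>.\<close>
    have "[i = j + n] (mod g)"
      using that(3) by (simp add: cong_def g mod_add_right_eq[symmetric, of j n])
    then have "g dvd j + n - i"
      using i by (metis cong_altdef_nat cong_sym less_imp_le trans_less_add2)
    then obtain m where m: "j + n - i = g * m" ..
    have "[i + (x * m) * d = i + g * m] (mod n)"
      using cong_scalar_right[OF x, of m] by (simp add: ac_simps cong_add_lcancel_nat)
    also have "i + g * m = j + n" using m i by linarith
    finally have "(i + (x * m) * d) mod n = j" using that(2) by (simp add: cong_def)
    with steps[OF that(1)] show ?thesis by metis
  qed
  \<comment> \<open>Since \<open>T\<close> is a union of residue classes modulo \<open>g\<close>, it
    is determined by its members below \<open>g\<close>.\<close>
  define R where "R = T \<inter> {0..<g}"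
  have gn: "g \<le> n" using n by (simp add: g)
  have iff: "i mod g \<in> R \<longleftrightarrow> i \<in> T" if "i < n" for i
  proof -
    have "i mod g < g" using g by simp
    then show ?thesis
      using closed[of i "i mod g"] closed[of "i mod g" i] that gn
      by (auto simp: R_def cong_def)
  qed
  have "p i = class_shift n s t g R i" for i
  proof (cases "i < n")
    case True
    then show ?thesis using iff p_or[of i] by (auto simp: class_shift_def T_def)
  next
    case False
    then show ?thesis using permutes_not_in[OF p, of i] by (simp add: class_shift_def)
  qed
  then show ?thesis by (auto simp: R_def)
qed

text \<open>The range splits into \<open>q\<close> blocks of length \<open>g\<close>, and each block
  runs through every residue modulo \<open>g\<close> exactly once.\<close>

lemma prod_mod:
  fixes f :: "nat \<Rightarrow> 'a :: comm_semiring_1"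
  shows "(\<Prod>i = 0..<q * g. f (i mod g)) = (\<Prod>r = 0..<g. f r ^ q)"
proof -
  have "(\<Prod>i = m * g..<m * g + g. f (i mod g)) = (\<Prod>r = 0..<g. f r)" for m
    by (simp add: prod.atLeastLessThan_shift_0[of _ "m * g"])
  then show ?thesis
    using prod.nat_group[of "\<lambda>i. f (i mod g)" g q]
    by (simp add: atLeast0LessThan flip: prod_power_distrib)
qed

text \<open>Expanding the power of the binomial, \<open>R\<close> records the factors from which
  \<open>y\<close> is chosen.\<close>

lemma prod_add_Pow:
  fixes x y :: "'a :: comm_semiring_1"
  assumes "finite A"
  shows "(\<Sum>R \<in> Pow A. \<Prod>r \<in> A. if r \<in> R then y else x) = (x + y) ^ card A"
proof -
  have "(\<Prod>r \<in> A. if r \<in> R then y else x) = (\<Prod>r \<in> R. y) * (\<Prod>r \<in> A - R. x)"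
    if "R \<in> Pow A" for R
  proof -
    have "A \<inter> {r. r \<in> R} = R" "A \<inter> - {r. r \<in> R} = A - R" using that by auto
    with assms show ?thesis by (simp add: prod.If_cases)
  qed
  then show ?thesis
    using prod_add[OF assms, of "\<lambda>_. y" "\<lambda>_. x"] by (simp add: add.commute)
qed

lemma permanent_two_shifts:
  fixes a b :: "'a :: comm_semiring_1"
  assumes st: "s < t" "t < n"
  defines "g \<equiv> gcd n (t - s)"
  shows "permanent (a \<cdot>\<^sub>m (cyclic_perm_mat n ^\<^sub>m s) + b \<cdot>\<^sub>m (cyclic_perm_mat n ^\<^sub>m t))
    = (a ^ (n div g) + b ^ (n div g)) ^ g"
proof -
  define A where "A = a \<cdot>\<^sub>m (cyclic_perm_mat n ^\<^sub>m s) + b \<cdot>\<^sub>m (cyclic_perm_mat n ^\<^sub>m t)"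
  let ?w = "\<lambda>p. \<Prod>i = 0..<n. A $$ (i, p i)"
  let ?F = "class_shift n s t g"
  have n: "n > 0" using st by simp
  have g: "g dvd n" "g > 0" "g \<le> n" using n by (auto simp: g_def intro: dvd_imp_le)
  have "[t = s] (mod g)"
    using st by (simp add: cong_altdef_nat g_def)
  then have perm: "?F R permutes {0..<n}" for R
    using class_shift_permutes[OF g(1)] by (simp add: cong_sym)
  have dim: "dim_row A = n" "dim_col A = n"
    by (simp_all add: A_def cyclic_perm_mat_pow)
  have entry: "A $$ (i, j) = (if j = (i + s) mod n then a else 0) + (if j = (i + t) mod n then b else 0)"
    if "i < n" "j < n" for i j
    using that by (simp add: A_def cyclic_perm_mat_pow cong_def)
  have w0: "?w p = 0" if p: "p permutes {0..<n}" and "p \<notin> ?F ` Pow {0..<g}" for p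
  proof -
    \<comment> \<open>Were \<open>p\<close> to follow one of the two shifts at every index, it would
      be a class shift. An index where it follows neither contributes a zero entry.\<close>
    obtain i where i: "i < n" "p i \<noteq> (i + s) mod n" "p i \<noteq> (i + t) mod n"
      using permutes_shift_or_imp_class_shift[OF st p] \<open>p \<notin> _\<close> by (auto simp: g_def)
    have "p i < n" using permutes_in_image[OF p, of i] i by simp
    with i have "A $$ (i, p i) = 0" by (simp add: entry)
    with i show ?thesis by (intro prod_zero) auto
  qed
  have w: "?w (?F R) = (\<Prod>r = 0..<g. if r \<in> R then b ^ (n div g) else a ^ (n div g))" for R
  proof -
    \<comment> \<open>The two shifts lead to different columns, so exactly one summand of the entry
      survives.\<close>
    have "A $$ (i, ?F R i) = (if i mod g \<in> R then b else a)" if "i < n" for i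
      using that n shift_mod_neq[OF st, of i] by (auto simp: entry class_shift_def)
    then have "?w (?F R) = (\<Prod>i = 0..<n div g * g. if i mod g \<in> R then b else a)"
      using g by (intro prod.cong) auto
    also have "\<dots> = (\<Prod>r = 0..<g. (if r \<in> R then b else a) ^ (n div g))"
      by (rule prod_mod)
    also have "\<dots> = (\<Prod>r = 0..<g. if r \<in> R then b ^ (n div g) else a ^ (n div g))"
      by (intro prod.cong) auto
    finally show ?thesis .
  qed
  have "permanent A = (\<Sum>p \<in> {p. p permutes {0..<n}}. ?w p)"
    by (simp add: permanent_def dim)
  also have "\<dots> = (\<Sum>p \<in> ?F ` Pow {0..<g}. ?w p)"
    using w0 perm by (intro sum.mono_neutral_right) (auto simp: finite_permutations)
  also have "\<dots> = (\<Sum>R \<in> Pow {0..<g}. ?w (?F R))"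
    using class_shift_inj_on[OF st g(3)] by (simp add: sum.reindex)
  also have "\<dots> = (a ^ (n div g) + b ^ (n div g)) ^ g"
    unfolding w by (simp add: prod_add_Pow)
  finally show ?thesis by (simp add: A_def)
qed

theorem corollary4p5:
  fixes n s\<^sub>1 s\<^sub>2 :: nat and a b :: complex
  assumes "s\<^sub>1 < s\<^sub>2" and "s\<^sub>2 < n"
    and "a \<noteq> 0" and "b \<noteq> 0"
  shows "permanent (a \<cdot>\<^sub>m (cyclic_perm_mat n ^\<^sub>m s\<^sub>1) + b \<cdot>\<^sub>m (cyclic_perm_mat n ^\<^sub>m s\<^sub>2))
    = (a ^ gcd_quot n (s\<^sub>2 - s\<^sub>1) + b ^ gcd_quot n (s\<^sub>2 - s\<^sub>1)) ^ gcd n (s\<^sub>2 - s\<^sub>1)"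
  unfolding gcd_quot_def using assms(1,2) by (rule permanent_two_shifts)

end
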